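(* Let $S$ be a monoid, and suppose that $S=\langle X\rangle$ for some subset $X\subseteq S$ such that each $x\in X$ is completely regular. Then $S$ is inverse with $E(S)=\langle X^0\rangle$ if and only if, for all $x,y\in X$, (i) $x^0y^0=y^0x^0$, and (ii) $y^{-1}x^0y\in\langle X^0\rangle$.
   Context: For a monoid $S$, $E(S)$ is the set of idempotents of $S$, and for a subset $Y\subseteq S$, $\langle Y\rangle$ is the submonoid of $S$ generated by $Y$ (it contains $1$). An element $x\in S$ is completely regular if its $\mathscr{H}$-class $H_x$ (Green's relation $\mathscr H$) is a group; in that case $x^{-1}$ denotes the inverse of $x$ in the group $H_x$ and $x^0$ denotes the identity element of $H_x$, so $xx^{-1}=x^{-1}x=x^0\in E(S)$. For a set $X$ of completely regular elements, $X^0=\{x^0\mid x\in X\}$. A monoid is inverse if every element $a$ has a unique $b$ with $aba=a$ and $bab=b$. *)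

theory Defs
  imports "HOL-Algebra.Coset"
begin

definition idempotents :: "('a, 'b) monoid_scheme \<Rightarrow> 'a set" where
  "idempotents S = {e \<in> carrier S. e \<otimes>\<^bsub>S\<^esub> e = e}"

definition submonoid_gen :: "('a, 'b) monoid_scheme \<Rightarrow> 'a set \<Rightarrow> 'a set" where
  "submonoid_gen S Y = \<Inter>{T. submonoid T S \<and> Y \<subseteq> T}"

text \<open>Green's relations. A monoid contains its identity, so equality of the principal one-sided
  ideals \<open>S x\<close> and \<open>x S\<close> can be used directly, without adjoining an identity.\<close>

definition green_L :: "('a, 'b) monoid_scheme \<Rightarrow> 'a \<Rightarrow> 'a \<Rightarrow> bool" where
  "green_L S x y \<longleftrightarrow> x \<in> carrier S \<and> y \<in> carrier S \<and> carrier S #>\<^bsub>S\<^esub> x = carrier S #>\<^bsub>S\<^esub> y"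

definition green_R :: "('a, 'b) monoid_scheme \<Rightarrow> 'a \<Rightarrow> 'a \<Rightarrow> bool" where
  "green_R S x y \<longleftrightarrow> x \<in> carrier S \<and> y \<in> carrier S \<and> x <#\<^bsub>S\<^esub> carrier S = y <#\<^bsub>S\<^esub> carrier S"

definition green_H :: "('a, 'b) monoid_scheme \<Rightarrow> 'a \<Rightarrow> 'a \<Rightarrow> bool" where
  "green_H S x y \<longleftrightarrow> green_L S x y \<and> green_R S x y"

definition H_class :: "('a, 'b) monoid_scheme \<Rightarrow> 'a \<Rightarrow> 'a set" where
  "H_class S x = {y. green_H S x y}"

text \<open>The multiplication of \<open>S\<close> on the \<open>\<H>\<close>-class of \<open>x\<close>, with \<open>e\<close> as prospective identity
  (in general different from the identity of \<open>S\<close>).\<close>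

definition H_struct :: "('a, 'b) monoid_scheme \<Rightarrow> 'a \<Rightarrow> 'a \<Rightarrow> 'a monoid" where
  "H_struct S x e = \<lparr>carrier = H_class S x, monoid.mult = (\<otimes>\<^bsub>S\<^esub>), one = e\<rparr>"

definition completely_regular :: "('a, 'b) monoid_scheme \<Rightarrow> 'a \<Rightarrow> bool" where
  "completely_regular S x \<longleftrightarrow> x \<in> carrier S \<and> (\<exists>e. group (H_struct S x e))"

text \<open>\<open>cr_one S x\<close> is \<open>x\<^sup>0\<close> and \<open>cr_inv S x\<close> is \<open>x\<^sup>-\<^sup>1\<close>; both are meaningful only for completely
  regular \<open>x\<close>.\<close>

definition cr_one :: "('a, 'b) monoid_scheme \<Rightarrow> 'a \<Rightarrow> 'a" where
  "cr_one S x = (THE e. group (H_struct S x e))"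

definition cr_inv :: "('a, 'b) monoid_scheme \<Rightarrow> 'a \<Rightarrow> 'a" where
  "cr_inv S x = inv\<^bsub>H_struct S x (cr_one S x)\<^esub> x"

definition inverse_monoid :: "('a, 'b) monoid_scheme \<Rightarrow> bool" where
  "inverse_monoid S \<longleftrightarrow> monoid S \<and>
    (\<forall>a \<in> carrier S. \<exists>!b. b \<in> carrier S \<and>
      a \<otimes>\<^bsub>S\<^esub> b \<otimes>\<^bsub>S\<^esub> a = a \<and> b \<otimes>\<^bsub>S\<^esub> a \<otimes>\<^bsub>S\<^esub> b = b)"

lemma group_H_struct_cr_one:
  assumes "completely_regular S x"
  shows "group (H_struct S x (cr_one S x))"
proof -
  obtain e where e: "group (H_struct S x e)"
    using assms by (auto simp: completely_regular_def)
  have "f = e" if f: "group (H_struct S x f)" for f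
  proof -
    have "f \<in> H_class S x" "e \<in> H_class S x"
      using group.is_monoid[OF f, THEN monoid.one_closed]
        group.is_monoid[OF e, THEN monoid.one_closed] by (simp_all add: H_struct_def)
    then show ?thesis
      using group.is_monoid[OF f, THEN monoid.r_one, of e]
        group.is_monoid[OF e, THEN monoid.l_one, of f] by (simp add: H_struct_def)
  qed
  with e show ?thesis
    unfolding cr_one_def by (rule theI)
qed

lemma cr_inv_props:
  assumes "completely_regular S x"
  shows "cr_inv S x \<in> H_class S x"
    and "x \<otimes>\<^bsub>S\<^esub> cr_inv S x = cr_one S x"
    and "cr_inv S x \<otimes>\<^bsub>S\<^esub> x = cr_one S x"
proof -
  let ?H = "H_struct S x (cr_one S x)"
  have G: "group ?H" by (rule group_H_struct_cr_one[OF assms])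
  have x: "x \<in> carrier ?H"
    using assms by (simp add: completely_regular_def H_struct_def H_class_def green_H_def
        green_L_def green_R_def)
  show "cr_inv S x \<in> H_class S x" "x \<otimes>\<^bsub>S\<^esub> cr_inv S x = cr_one S x"
    "cr_inv S x \<otimes>\<^bsub>S\<^esub> x = cr_one S x"
    using group.inv_closed[OF G x] group.r_inv[OF G x] group.l_inv[OF G x]
    unfolding cr_inv_def by (simp_all add: H_struct_def)
qed

end

theory Submission
  imports Defs
begin

text \<open>
  For the substantial direction, let \<open>E = \<langle>X\<^sup>0\<rangle>\<close>, a commutative band by (i). The elements \<open>s\<close> that
  have some \<open>t\<close> with \<open>s t s = s\<close>, \<open>t E s \<subseteq> E\<close> and \<open>e s = s (t e s)\<close> for all \<open>e \<in> E\<close> form a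
  submonoid, which contains \<open>X\<close> by (ii); hence every element of \<open>S\<close> is of this kind and \<open>S\<close> is
  regular. If moreover \<open>s s = s\<close>, put \<open>e = t s\<close> and \<open>f = t e s\<close>, both in \<open>E\<close>. Then \<open>s e = s\<close>,
  \<open>e s = e\<close> and \<open>s f = e s = e\<close>, so \<open>e f = s f f = s f = e\<close>; since also \<open>e f = f e = f\<close>, we get
  \<open>f = e\<close> and \<open>s = s e = s f = e \<in> E\<close>. So the idempotents are exactly \<open>E\<close> and commute, and a
  regular monoid with commuting idempotents is inverse.
\<close>

context monoid
begin

section \<open>Generated submonoids, commuting generators and idempotents\<close>

lemma submonoid_gen_is_submonoid:
  assumes "Y \<subseteq> carrier G"
  shows "submonoid (submonoid_gen G Y) G"
proof
  have "submonoid (carrier G) G"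
    by unfold_locales auto
  with assms show "submonoid_gen G Y \<subseteq> carrier G"
    by (auto simp: submonoid_gen_def)
qed (auto simp: submonoid_gen_def submonoid.m_closed submonoid.one_closed)

lemma subset_submonoid_gen: "Y \<subseteq> submonoid_gen G Y"
  by (auto simp: submonoid_gen_def)

lemma submonoid_gen_least:
  assumes "submonoid T G" "Y \<subseteq> T"
  shows "submonoid_gen G Y \<subseteq> T"
  using assms by (auto simp: submonoid_gen_def)

lemma submonoid_centralizer:
  assumes "A \<subseteq> carrier G"
  shows "submonoid {x \<in> carrier G. \<forall>a\<in>A. x \<otimes> a = a \<otimes> x} G"
proof
  fix x y
  assume "x \<in> {x \<in> carrier G. \<forall>a\<in>A. x \<otimes> a = a \<otimes> x}"
    and "y \<in> {x \<in> carrier G. \<forall>a\<in>A. x \<otimes> a = a \<otimes> x}"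
  then show "x \<otimes> y \<in> {x \<in> carrier G. \<forall>a\<in>A. x \<otimes> a = a \<otimes> x}"
    using assms by (auto simp: subset_iff) (metis m_assoc)
qed (use assms in auto)

text \<open>Centralizers are submonoids, so they are used twice: the centralizer of \<open>Y\<close>
  contains \<open>Y\<close> and hence all that \<open>Y\<close> generates; thus \<open>Y\<close>
  lies in the centralizer of the generated submonoid, and so does everything generated by
  \<open>Y\<close>.\<close>

lemma submonoid_gen_commute:
  assumes Y: "Y \<subseteq> carrier G"
    and comm: "\<And>x y. x \<in> Y \<Longrightarrow> y \<in> Y \<Longrightarrow> x \<otimes> y = y \<otimes> x"
    and "x \<in> submonoid_gen G Y" "y \<in> submonoid_gen G Y"
  shows "x \<otimes> y = y \<otimes> x"
proof -
  let ?C = "\<lambda>A. {x \<in> carrier G. \<forall>a\<in>A. x \<otimes> a = a \<otimes> x}"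
  have "submonoid_gen G Y \<subseteq> ?C Y"
    using Y comm by (intro submonoid_gen_least submonoid_centralizer) auto
  then have "Y \<subseteq> ?C (submonoid_gen G Y)"
    using Y by fastforce
  then have "submonoid_gen G Y \<subseteq> ?C (submonoid_gen G Y)"
    by (rule submonoid_gen_least[OF submonoid_centralizer
          [OF submonoid.subset[OF submonoid_gen_is_submonoid[OF Y]]]])
  with assms(3,4) show ?thesis
    by auto
qed

lemma idempotent_mult:
  assumes "a \<in> idempotents G" "b \<in> idempotents G" "a \<otimes> b = b \<otimes> a"
  shows "a \<otimes> b \<in> idempotents G"
proof -
  have ab: "a \<in> carrier G" "b \<in> carrier G" "a \<otimes> a = a" "b \<otimes> b = b"
    using assms by (auto simp: idempotents_def)
  have "(a \<otimes> b) \<otimes> (a \<otimes> b) = (a \<otimes> (b \<otimes> a)) \<otimes> b"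
    using ab by (simp add: m_assoc)
  also have "\<dots> = (a \<otimes> a) \<otimes> (b \<otimes> b)"
    using ab(1,2) by (simp add: assms(3)[symmetric] m_assoc)
  finally show ?thesis
    using ab by (simp add: idempotents_def)
qed

text \<open>Idempotents need not be closed under products. Within the submonoid generated by
  \<open>Y\<close> they commute, so intersecting with it gives a submonoid that still contains
  \<open>Y\<close>.\<close>

lemma submonoid_gen_idempotents:
  assumes Y: "Y \<subseteq> idempotents G"
    and comm: "\<And>x y. x \<in> Y \<Longrightarrow> y \<in> Y \<Longrightarrow> x \<otimes> y = y \<otimes> x"
  shows "submonoid_gen G Y \<subseteq> idempotents G"
proof -
  let ?E = "submonoid_gen G Y"
  have Yc: "Y \<subseteq> carrier G"
    using Y by (auto simp: idempotents_def)
  interpret E: submonoid ?E G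
    by (rule submonoid_gen_is_submonoid[OF Yc])
  have "submonoid (idempotents G \<inter> ?E) G"
    by unfold_locales
      (auto intro!: idempotent_mult submonoid_gen_commute[OF Yc comm],
        auto simp: idempotents_def)
  then show ?thesis
    using submonoid_gen_least[of "idempotents G \<inter> ?E" Y] Y subset_submonoid_gen by auto
qed

section \<open>Inverse monoids as regular monoids with commuting idempotents\<close>

lemma inverse_monoid_idempotents_commute:
  assumes inv: "inverse_monoid G"
    and e: "e \<in> idempotents G" and f: "f \<in> idempotents G"
  shows "e \<otimes> f = f \<otimes> e"
proof -
  have uniq: "b = c"
    if "a \<in> carrier G" "b \<in> carrier G" "c \<in> carrier G"
      "a \<otimes> b \<otimes> a = a" "b \<otimes> a \<otimes> b = b" "a \<otimes> c \<otimes> a = a" "c \<otimes> a \<otimes> c = c" for a b c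
    using inv that unfolding inverse_monoid_def by blast
  have idem: "(g \<otimes> h) \<otimes> (g \<otimes> h) = g \<otimes> h"
    if g: "g \<in> idempotents G" and h: "h \<in> idempotents G" for g h
  proof -
    have c: "g \<in> carrier G" "h \<in> carrier G" and gg: "g \<otimes> g = g" and hh: "h \<otimes> h = h"
      using g h by (auto simp: idempotents_def)
    \<comment> \<open>Versions of the idempotent laws that apply inside right-nested
      products.\<close>
    have gg': "g \<otimes> (g \<otimes> z) = g \<otimes> z" and hh': "h \<otimes> (h \<otimes> z) = h \<otimes> z"
      if "z \<in> carrier G" for z
      using c gg hh that by (simp_all flip: m_assoc)
    obtain b where b: "b \<in> carrier G"
      and gh: "g \<otimes> h \<otimes> b \<otimes> (g \<otimes> h) = g \<otimes> h" and b2: "b \<otimes> (g \<otimes> h) \<otimes> b = b"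
      using inv c unfolding inverse_monoid_def by (meson m_closed)
    have b2': "b \<otimes> (g \<otimes> (h \<otimes> (b \<otimes> z))) = b \<otimes> z" if "z \<in> carrier G" for z
      using arg_cong[OF b2, of "\<lambda>u. u \<otimes> z"] b c that by (simp add: m_assoc)
    \<comment> \<open>If \<open>b\<close> is an inverse of \<open>g \<otimes> h\<close>, then so is
      \<open>h \<otimes> b \<otimes> g\<close>. By uniqueness they agree, and this form of
      \<open>b\<close> shows that \<open>b\<close> is idempotent.\<close>
    have beq: "b = h \<otimes> b \<otimes> g"
      by (rule uniq[of "g \<otimes> h"]) (use b c gg' hh' gh b2 b2' in \<open>simp_all add: m_assoc\<close>)
    have "b \<otimes> b = (h \<otimes> b \<otimes> g) \<otimes> (h \<otimes> b \<otimes> g)"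
      using beq by simp
    also have "\<dots> = h \<otimes> b \<otimes> g"
      using b c b2' by (simp add: m_assoc)
    finally have bb: "b \<otimes> b = b"
      using beq by simp
    \<comment> \<open>The idempotent \<open>b\<close> is an inverse of itself, and
      \<open>g \<otimes> h\<close> is another inverse of it.\<close>
    have "b = g \<otimes> h"
      by (rule uniq[of b]) (use b c bb gh b2 in simp_all)
    with bb show ?thesis
      by simp
  qed
  have c: "e \<in> carrier G" "f \<in> carrier G" and ee: "e \<otimes> e = e" and ff: "f \<otimes> f = f"
    using e f by (auto simp: idempotents_def)
  have ee': "e \<otimes> (e \<otimes> z) = e \<otimes> z" and ff': "f \<otimes> (f \<otimes> z) = f \<otimes> z" if "z \<in> carrier G" for z
    using c ee ff that by (simp_all flip: m_assoc)
  show ?thesis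
    \<comment> \<open>Since \<open>e \<otimes> f\<close> and \<open>f \<otimes> e\<close> are both
      idempotent, each of them is an inverse of \<open>e \<otimes> f\<close>.\<close>
    by (rule uniq[of "e \<otimes> f"])
      (use c ee' ff' idem[OF e f] idem[OF f e] in \<open>simp_all add: m_assoc\<close>)
qed

text \<open>Regularity gives an inverse \<open>b \<otimes> a \<otimes> b\<close>. For two inverses
  \<open>p\<close> and \<open>q\<close> of \<open>a\<close>, commuting \<open>p \<otimes> a\<close>
  with \<open>q \<otimes> a\<close> and then \<open>a \<otimes> q\<close> with
  \<open>a \<otimes> p\<close> turns \<open>p\<close> into \<open>q\<close>.\<close>

lemma inverse_monoidI:
  assumes comm: "\<And>e f. e \<in> idempotents G \<Longrightarrow> f \<in> idempotents G \<Longrightarrow> e \<otimes> f = f \<otimes> e"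
    and reg: "\<And>a. a \<in> carrier G \<Longrightarrow> \<exists>b \<in> carrier G. a \<otimes> b \<otimes> a = a"
  shows "inverse_monoid G"
  unfolding inverse_monoid_def
proof (intro conjI ballI)
  show "monoid G" by (rule monoid_axioms)
  fix a assume a: "a \<in> carrier G"
  then obtain b where b: "b \<in> carrier G" and aba: "a \<otimes> b \<otimes> a = a"
    using reg by blast
  have aba': "a \<otimes> (b \<otimes> (a \<otimes> z)) = a \<otimes> z" if "z \<in> carrier G" for z
    using arg_cong[OF aba, of "\<lambda>u. u \<otimes> z"] a b that by (simp add: m_assoc)
  show "\<exists>!b. b \<in> carrier G \<and> a \<otimes> b \<otimes> a = a \<and> b \<otimes> a \<otimes> b = b"
  proof (rule ex_ex1I)
    show "\<exists>b. b \<in> carrier G \<and> a \<otimes> b \<otimes> a = a \<and> b \<otimes> a \<otimes> b = b"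
      by (rule exI[of _ "b \<otimes> a \<otimes> b"]) (use a b aba aba' in \<open>simp add: m_assoc\<close>)
    fix p q
    assume "p \<in> carrier G \<and> a \<otimes> p \<otimes> a = a \<and> p \<otimes> a \<otimes> p = p"
      and "q \<in> carrier G \<and> a \<otimes> q \<otimes> a = a \<and> q \<otimes> a \<otimes> q = q"
    then have p: "p \<in> carrier G" "a \<otimes> p \<otimes> a = a" "p \<otimes> a \<otimes> p = p"
      and q: "q \<in> carrier G" "a \<otimes> q \<otimes> a = a" "q \<otimes> a \<otimes> q = q"
      by auto
    have id: "p \<otimes> a \<in> idempotents G" "q \<otimes> a \<in> idempotents G"
      "a \<otimes> p \<in> idempotents G" "a \<otimes> q \<in> idempotents G"
      using a p q by (simp_all add: idempotents_def flip: m_assoc)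
    have "p = p \<otimes> (a \<otimes> q \<otimes> a) \<otimes> p"
      using p q by simp
    also have "\<dots> = (p \<otimes> a) \<otimes> (q \<otimes> a) \<otimes> p"
      using a p(1) q(1) by (simp add: m_assoc)
    also have "\<dots> = (q \<otimes> a) \<otimes> (p \<otimes> a) \<otimes> p"
      using comm[OF id(1,2)] by simp
    also have "\<dots> = q \<otimes> a \<otimes> p"
      using a p q(1) by (simp add: m_assoc)
    also have "\<dots> = (q \<otimes> a \<otimes> q) \<otimes> a \<otimes> p"
      using q by simp
    also have "\<dots> = q \<otimes> ((a \<otimes> q) \<otimes> (a \<otimes> p))"
      using a p(1) q(1) by (simp add: m_assoc)
    also have "\<dots> = q \<otimes> ((a \<otimes> p) \<otimes> (a \<otimes> q))"
      using comm[OF id(3,4)] by simp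
    also have "\<dots> = q \<otimes> ((a \<otimes> p \<otimes> a) \<otimes> q)"
      using a p(1) q(1) by (simp add: m_assoc)
    also have "\<dots> = q"
      using a p q by (simp add: m_assoc)
    finally show "p = q" .
  qed
qed

section \<open>Group identities of completely regular elements, read in the monoid\<close>

lemma completely_regular_props:
  assumes "completely_regular G x"
  shows "x \<in> carrier G" "cr_one G x \<in> carrier G" "cr_inv G x \<in> carrier G"
    "cr_one G x \<otimes> x = x" "cr_inv G x \<otimes> cr_one G x = cr_inv G x"
    "cr_one G x \<otimes> cr_one G x = cr_one G x"
proof -
  let ?H = "H_struct G x (cr_one G x)"
  interpret H: group ?H by (rule group_H_struct_cr_one[OF assms])
  show x: "x \<in> carrier G"
    using assms by (simp add: completely_regular_def)
  then have xH: "x \<in> carrier ?H"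
    by (simp add: H_struct_def H_class_def green_H_def green_L_def green_R_def)
  have iH: "cr_inv G x \<in> carrier ?H"
    using cr_inv_props(1)[OF assms] by (simp add: H_struct_def)
  have sub: "carrier ?H \<subseteq> carrier G"
    by (auto simp: H_struct_def H_class_def green_H_def green_L_def)
  have one: "\<one>\<^bsub>?H\<^esub> = cr_one G x" and mult: "a \<otimes>\<^bsub>?H\<^esub> b = a \<otimes> b" for a b
    by (simp_all add: H_struct_def)
  show "cr_one G x \<in> carrier G" "cr_inv G x \<in> carrier G"
    using sub iH H.one_closed unfolding one by auto
  show "cr_one G x \<otimes> x = x" "cr_inv G x \<otimes> cr_one G x = cr_inv G x"
    "cr_one G x \<otimes> cr_one G x = cr_one G x"
    using H.l_one[OF xH] H.r_one[OF iH] H.l_one[OF H.one_closed] unfolding one mult by auto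
qed

section \<open>Conjugation of idempotents by regular elements\<close>

text \<open>\<open>conj_inverse E s t\<close>: the element \<open>t\<close> plays the role of an inverse of \<open>s\<close>, although \<open>t s t = t\<close>
  is not required.\<close>

definition conj_inverse :: "'a set \<Rightarrow> 'a \<Rightarrow> 'a \<Rightarrow> bool" where
  "conj_inverse E s t \<longleftrightarrow> t \<in> carrier G \<and> s \<otimes> t \<otimes> s = s \<and>
    (\<forall>e\<in>E. t \<otimes> e \<otimes> s \<in> E \<and> e \<otimes> s = s \<otimes> (t \<otimes> e \<otimes> s))"

text \<open>Conjugating by a product is conjugating twice: first by \<open>s\<close>, which stays in
  \<open>E\<close>, then by \<open>t\<close>. An element of \<open>E\<close> is likewise moved past
  \<open>s\<close> and then past \<open>t\<close>.\<close>

lemma conj_inverse_mult: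
  assumes "submonoid E G"
    and s: "s \<in> carrier G" "conj_inverse E s s'" and t: "t \<in> carrier G" "conj_inverse E t t'"
  shows "conj_inverse E (s \<otimes> t) (t' \<otimes> s')"
proof -
  interpret E: submonoid E G by fact
  have c: "s' \<in> carrier G" "t' \<in> carrier G" and ss: "s \<otimes> s' \<otimes> s = s" and tt: "t \<otimes> t' \<otimes> t = t"
    using s t by (auto simp: conj_inverse_def)
  have S: "s' \<otimes> e \<otimes> s \<in> E" "e \<otimes> s = s \<otimes> (s' \<otimes> e \<otimes> s)" if "e \<in> E" for e
    using s that by (auto simp: conj_inverse_def)
  have T: "t' \<otimes> e \<otimes> t \<in> E" "e \<otimes> t = t \<otimes> (t' \<otimes> e \<otimes> t)" if "e \<in> E" for e
    using t that by (auto simp: conj_inverse_def)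
  \<comment> \<open>As the conjugate of the identity by \<open>s\<close>, this lies in
    \<open>E\<close>, so it can be moved past \<open>t\<close>; that yields regularity of
    \<open>s \<otimes> t\<close>.\<close>
  define h where "h = s' \<otimes> s"
  have h: "h \<in> E"
    using S(1)[OF E.one_closed] c by (simp add: h_def)
  then have hc: "h \<in> carrier G" by auto
  have "(s \<otimes> t) \<otimes> (t' \<otimes> s') \<otimes> (s \<otimes> t) = s \<otimes> (t \<otimes> (t' \<otimes> h \<otimes> t))"
    using s(1) t(1) c by (simp add: h_def m_assoc)
  also have "\<dots> = s \<otimes> (h \<otimes> t)"
    using T(2)[OF h] by simp
  also have "\<dots> = (s \<otimes> s' \<otimes> s) \<otimes> t"
    using s(1) t(1) c by (simp add: h_def m_assoc)
  finally have reg: "(s \<otimes> t) \<otimes> (t' \<otimes> s') \<otimes> (s \<otimes> t) = s \<otimes> t"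
    using ss by simp
  have conj: "(t' \<otimes> s') \<otimes> e \<otimes> (s \<otimes> t) \<in> E \<and>
    e \<otimes> (s \<otimes> t) = (s \<otimes> t) \<otimes> ((t' \<otimes> s') \<otimes> e \<otimes> (s \<otimes> t))" if e: "e \<in> E" for e
  proof -
    have ec: "e \<in> carrier G" using e by auto
    define g where "g = s' \<otimes> e \<otimes> s"
    have g: "g \<in> E" and gc: "g \<in> carrier G"
      using S(1)[OF e] by (auto simp: g_def)
    have eq: "(t' \<otimes> s') \<otimes> e \<otimes> (s \<otimes> t) = t' \<otimes> g \<otimes> t"
      using s(1) t(1) c ec by (simp add: g_def m_assoc)
    have "e \<otimes> (s \<otimes> t) = (e \<otimes> s) \<otimes> t"
      using s(1) t(1) ec by (simp add: m_assoc)
    also have "\<dots> = s \<otimes> (g \<otimes> t)"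
      using S(2)[OF e] s(1) t(1) gc by (simp add: m_assoc flip: g_def)
    also have "\<dots> = s \<otimes> (t \<otimes> (t' \<otimes> g \<otimes> t))"
      using T(2)[OF g] by simp
    also have "\<dots> = (s \<otimes> t) \<otimes> (t' \<otimes> g \<otimes> t)"
      using s(1) t(1) c gc by (simp add: m_assoc)
    finally show ?thesis
      using T(1)[OF g] unfolding eq by simp
  qed
  show ?thesis
    using c reg conj by (simp add: conj_inverse_def)
qed

lemma submonoid_conj_inverse:
  assumes "submonoid E G"
  shows "submonoid {s \<in> carrier G. \<exists>t. conj_inverse E s t} G"
proof
  interpret E: submonoid E G by fact
  have "conj_inverse E \<one> \<one>"
    by (auto simp: conj_inverse_def)
  then show "\<one> \<in> {s \<in> carrier G. \<exists>t. conj_inverse E s t}"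
    by auto
qed (use conj_inverse_mult[OF assms] in \<open>auto, blast\<close>)

lemma idempotent_conj_inverse_mem:
  assumes "submonoid E G"
    and idem: "E \<subseteq> idempotents G"
    and comm: "\<And>e f. e \<in> E \<Longrightarrow> f \<in> E \<Longrightarrow> e \<otimes> f = f \<otimes> e"
    and s: "s \<in> idempotents G" and "conj_inverse E s t"
  shows "s \<in> E"
proof -
  interpret E: submonoid E G by fact
  have sc: "s \<in> carrier G" and ss: "s \<otimes> s = s"
    using s by (auto simp: idempotents_def)
  have tc: "t \<in> carrier G" and sts: "s \<otimes> t \<otimes> s = s"
    and T: "\<And>e. e \<in> E \<Longrightarrow> t \<otimes> e \<otimes> s \<in> E" "\<And>e. e \<in> E \<Longrightarrow> e \<otimes> s = s \<otimes> (t \<otimes> e \<otimes> s)"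
    using assms(5) by (auto simp: conj_inverse_def)
  define e where "e = t \<otimes> s"
  have e: "e \<in> E"
    using T(1)[OF E.one_closed] tc by (simp add: e_def)
  define f where "f = t \<otimes> e \<otimes> s"
  have f: "f \<in> E"
    unfolding f_def by (rule T(1)[OF e])
  have ec: "e \<in> carrier G" and fc: "f \<in> carrier G" and ff: "f \<otimes> f = f"
    using e f idem by (auto simp: idempotents_def)
  have se: "s \<otimes> e = s" and es: "e \<otimes> s = e"
    using sts ss sc tc by (simp_all add: e_def m_assoc)
  have sf: "s \<otimes> f = e"
    using T(2)[OF e] es by (simp add: f_def)
  have fe: "f \<otimes> e = f"
    using se sc tc ec by (simp add: f_def m_assoc)
  have "e \<otimes> f = e"
    using sf ff sc fc by (metis m_assoc)
  then have "f = e"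
    using fe comm[OF e f] by simp
  with sf se e show ?thesis
    by simp
qed

text \<open>Condition (ii) speaks of generators of the idempotent submonoid only. It extends to
  products because conjugation by y is multiplicative there, which follows from the law
  \<open>pull\<close>.\<close>

lemma conj_inverse_cr_inv:
  assumes Y: "Y \<subseteq> idempotents G"
    and comm: "\<And>a b. a \<in> Y \<Longrightarrow> b \<in> Y \<Longrightarrow> a \<otimes> b = b \<otimes> a"
    and y: "completely_regular G y" "cr_one G y \<in> Y"
    and conj: "\<And>a. a \<in> Y \<Longrightarrow> cr_inv G y \<otimes> a \<otimes> y \<in> submonoid_gen G Y"
  shows "conj_inverse (submonoid_gen G Y) y (cr_inv G y)"
proof -
  let ?E = "submonoid_gen G Y" and ?i = "cr_inv G y" and ?o = "cr_one G y"
  have Yc: "Y \<subseteq> carrier G"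
    using Y by (auto simp: idempotents_def)
  interpret E: submonoid ?E G
    by (rule submonoid_gen_is_submonoid[OF Yc])
  note p = completely_regular_props[OF y(1)] and q = cr_inv_props[OF y(1)]
  have oE: "?o \<in> ?E"
    using y(2) subset_submonoid_gen by auto
  have com: "a \<otimes> b = b \<otimes> a" if "a \<in> ?E" "b \<in> ?E" for a b
    using submonoid_gen_commute[OF Yc comm that] .
  \<comment> \<open>Insert y^0 before y, commute it with \<open>e\<close>, and write it as y
    y^-1.\<close>
  have pull: "e \<otimes> y = y \<otimes> (?i \<otimes> e \<otimes> y)" if e: "e \<in> ?E" for e
  proof -
    have ec: "e \<in> carrier G" using e by auto
    have "e \<otimes> y = (e \<otimes> ?o) \<otimes> y"
      using p ec by (simp add: m_assoc)
    also have "\<dots> = (y \<otimes> ?i) \<otimes> e \<otimes> y"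
      using com[OF e oE] q by simp
    finally show ?thesis
      using p ec by (simp add: m_assoc)
  qed
  have "submonoid {e \<in> ?E. ?i \<otimes> e \<otimes> y \<in> ?E} G"
  proof
    \<comment> \<open>The conjugate of the identity is y^0, itself a generator.\<close>
    show "\<one> \<in> {e \<in> ?E. ?i \<otimes> e \<otimes> y \<in> ?E}"
      using oE p q by simp
    fix a b
    assume a: "a \<in> {e \<in> ?E. ?i \<otimes> e \<otimes> y \<in> ?E}" and b: "b \<in> {e \<in> ?E. ?i \<otimes> e \<otimes> y \<in> ?E}"
    have ac: "a \<in> carrier G" "b \<in> carrier G" using a b by auto
    have "?i \<otimes> (a \<otimes> b) \<otimes> y = ?i \<otimes> a \<otimes> (b \<otimes> y)"
      using p ac by (simp add: m_assoc)
    also have "\<dots> = ?i \<otimes> a \<otimes> (y \<otimes> (?i \<otimes> b \<otimes> y))"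
      using pull[of b] b by simp
    also have "\<dots> = (?i \<otimes> a \<otimes> y) \<otimes> (?i \<otimes> b \<otimes> y)"
      using p ac by (simp add: m_assoc)
    finally show "a \<otimes> b \<in> {e \<in> ?E. ?i \<otimes> e \<otimes> y \<in> ?E}"
      using a b by simp
  qed auto
  then have "?E \<subseteq> {e \<in> ?E. ?i \<otimes> e \<otimes> y \<in> ?E}"
    by (rule submonoid_gen_least) (use conj subset_submonoid_gen in auto)
  then show ?thesis
    using pull p q by (auto simp: conj_inverse_def)
qed

end

section \<open>The equivalence between the inverse property and conditions (i) and (ii)\<close>

theorem proposition1:
  fixes S :: "('a, 'b) monoid_scheme" and X :: "'a set"
  assumes "monoid S"
    and "X \<subseteq> carrier S"
    and "carrier S = submonoid_gen S X"
    and "\<And>x. x \<in> X \<Longrightarrow> completely_regular S x"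
  shows "(inverse_monoid S \<and> idempotents S = submonoid_gen S (cr_one S ` X)) \<longleftrightarrow>
    (\<forall>x \<in> X. \<forall>y \<in> X.
      cr_one S x \<otimes>\<^bsub>S\<^esub> cr_one S y = cr_one S y \<otimes>\<^bsub>S\<^esub> cr_one S x \<and>
      cr_inv S y \<otimes>\<^bsub>S\<^esub> cr_one S x \<otimes>\<^bsub>S\<^esub> y \<in> submonoid_gen S (cr_one S ` X))"
  (is "?L \<longleftrightarrow> ?R")
proof
  interpret monoid S by fact
  let ?Y = "cr_one S ` X" and ?E = "submonoid_gen S (cr_one S ` X)"
  note p = completely_regular_props[OF assms(4)] and q = cr_inv_props[OF assms(4)]
  have Y: "?Y \<subseteq> idempotents S"
    using p by (auto simp: idempotents_def)
  then have Yc: "?Y \<subseteq> carrier S"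
    by (auto simp: idempotents_def)
  {
    assume L: ?L
    show ?R
    proof (intro ballI conjI)
      fix x y assume x: "x \<in> X" and y: "y \<in> X"
      let ?i = "cr_inv S y" and ?e = "cr_one S x" and ?f = "cr_one S y"
      show comm: "?e \<otimes>\<^bsub>S\<^esub> ?f = ?f \<otimes>\<^bsub>S\<^esub> ?e"
        using L x y Y by (intro inverse_monoid_idempotents_commute) auto
      \<comment> \<open>The conjugate of x^0 is idempotent: the inner factor y y^-1 is y^0, which
        commutes with x^0 and is absorbed by y^-1. Condition (ii) follows as all idempotents lie in
        \<open>?E\<close>.\<close>
      have "(?i \<otimes>\<^bsub>S\<^esub> ?e \<otimes>\<^bsub>S\<^esub> y) \<otimes>\<^bsub>S\<^esub> (?i \<otimes>\<^bsub>S\<^esub> ?e \<otimes>\<^bsub>S\<^esub> y) =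
          ?i \<otimes>\<^bsub>S\<^esub> (?e \<otimes>\<^bsub>S\<^esub> (y \<otimes>\<^bsub>S\<^esub> ?i)) \<otimes>\<^bsub>S\<^esub> ?e \<otimes>\<^bsub>S\<^esub> y"
        using p[OF x] p[OF y] by (simp add: m_assoc)
      also have "\<dots> = ?i \<otimes>\<^bsub>S\<^esub> (?f \<otimes>\<^bsub>S\<^esub> ?e) \<otimes>\<^bsub>S\<^esub> ?e \<otimes>\<^bsub>S\<^esub> y"
        using q[OF y] comm by simp
      also have "\<dots> = (?i \<otimes>\<^bsub>S\<^esub> ?f) \<otimes>\<^bsub>S\<^esub> (?e \<otimes>\<^bsub>S\<^esub> ?e) \<otimes>\<^bsub>S\<^esub> y"
        using p(1-3)[OF x] p(1-3)[OF y] by (simp add: m_assoc)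
      also have "\<dots> = ?i \<otimes>\<^bsub>S\<^esub> ?e \<otimes>\<^bsub>S\<^esub> y"
        using p[OF x] p[OF y] by simp
      finally have "?i \<otimes>\<^bsub>S\<^esub> ?e \<otimes>\<^bsub>S\<^esub> y \<in> idempotents S"
        using p[OF x] p[OF y] by (simp add: idempotents_def)
      with L show "?i \<otimes>\<^bsub>S\<^esub> ?e \<otimes>\<^bsub>S\<^esub> y \<in> ?E"
        by simp
    qed
  next
    assume R: ?R
    have E: "submonoid ?E S"
      by (rule submonoid_gen_is_submonoid[OF Yc])
    have commY: "a \<otimes>\<^bsub>S\<^esub> b = b \<otimes>\<^bsub>S\<^esub> a" if "a \<in> ?Y" "b \<in> ?Y" for a b
      using that R by blast
    have comm: "a \<otimes>\<^bsub>S\<^esub> b = b \<otimes>\<^bsub>S\<^esub> a" if "a \<in> ?E" "b \<in> ?E" for a b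
      using submonoid_gen_commute[OF Yc commY that] .
    have EI: "?E \<subseteq> idempotents S"
      by (rule submonoid_gen_idempotents[OF Y commY])
    have gen: "conj_inverse ?E y (cr_inv S y)" if y: "y \<in> X" for y
      by (rule conj_inverse_cr_inv[OF Y commY]) (use R y assms(4) in auto)
    \<comment> \<open>Since X generates S, having a conjugating inverse passes from the generators
      to every element.\<close>
    have "submonoid_gen S X \<subseteq> {s \<in> carrier S. \<exists>t. conj_inverse ?E s t}"
      by (rule submonoid_gen_least[OF submonoid_conj_inverse[OF E]]) (use gen assms(2) in auto)
    then have all: "\<exists>t. conj_inverse ?E s t" if "s \<in> carrier S" for s
      using that assms(3) by auto
    have "s \<in> ?E" if s: "s \<in> idempotents S" for s
    proof -
      obtain t where "conj_inverse ?E s t"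
        using all s by (auto simp: idempotents_def)
      with E EI comm s show ?thesis
        by (rule idempotent_conj_inverse_mem)
    qed
    with EI have eq: "idempotents S = ?E"
      by auto
    have "inverse_monoid S"
    proof (rule inverse_monoidI)
      show "\<exists>b\<in>carrier S. a \<otimes>\<^bsub>S\<^esub> b \<otimes>\<^bsub>S\<^esub> a = a" if "a \<in> carrier S" for a
        using all[OF that] by (auto simp: conj_inverse_def)
    qed (use comm eq in auto)
    with eq show ?L
      by simp
  }
qed

end
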